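(* There is no cubefree word $x$ over the binary alphabet $\{0,1\}$ of (finite) length greater than $17$ whose curling-number transform $C(x)$ is also cubefree.
   Context: Words are indexed from $0$: a finite word of length $n$ is $x = x[0]x[1]\cdots x[n-1]$, and $x[i..j]$ denotes the factor (contiguous block) $x[i]\cdots x[j]$. A finite or infinite word is cubefree if it contains no factor of the form $yyy$ with $y$ a nonempty word. The curling number of a nonempty finite word $u$ is the largest integer $k \ge 1$ such that $u = y z^k$ for some (possibly empty) word $y$ and some nonempty word $z$. For a finite or infinite word $x$, the curling-number transform $C(x)$ is the word over the positive integers, of the same length as $x$, whose $i$-th letter $C(x)[i]$ is the curling number of the prefix $x[0..i]$. *)

theory Defs
  imports Main "HOL-Library.Sublist"
begin

definition cubefree :: "'a list \<Rightarrow> bool" where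
  "cubefree x \<longleftrightarrow> \<not> (\<exists>y. y \<noteq> [] \<and> sublist (y @ y @ y) x)"

definition word_power :: "'a list \<Rightarrow> nat \<Rightarrow> 'a list" where
  "word_power z k = concat (replicate k z)"

(* Intended for nonempty u only. There the set is nonempty (k = 1, z = u), and it is
   bounded by length u because z is nonempty, so Max is the true maximum. *)
definition curling_number :: "'a list \<Rightarrow> nat" where
  "curling_number u = Max {k. k \<ge> 1 \<and> (\<exists>y z. z \<noteq> [] \<and> u = y @ word_power z k)}"

(* Letter i is computed from x[0..i], the prefix of length i + 1. *)
definition curling_transform :: "'a list \<Rightarrow> nat list" where
  "curling_transform x = map (\<lambda>i. curling_number (take (Suc i) x)) [0..<length x]"

end

theory Submission
  imports Defs
begin

text \<open>
  The last letter of a cubefree word's transform is 2 if the word ends with a square, and 1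
  otherwise. Both cubefreeness conditions are inherited by prefixes, so all admissible
  words can be enumerated letter by letter, checking only for cubes at the end; the
  enumeration dies out at length 18.
\<close>

text \<open>The base \<open>z\<close> ranges over the finite set of suffixes of \<open>w\<close>, so
  that the predicate is executable.\<close>

definition ends_with_power :: "nat \<Rightarrow> 'a list \<Rightarrow> bool" where
  "ends_with_power k w \<longleftrightarrow> (\<exists>z\<in>set (suffixes w). z \<noteq> [] \<and> suffix (word_power z k) w)"

lemma word_power_numeral [simp]:
  "word_power z (Suc 0) = z" "word_power z 2 = z @ z" "word_power z 3 = z @ z @ z"
  by (simp_all add: word_power_def numeral_eq_Suc)

lemma word_power_add: "word_power z (m + n) = word_power z m @ word_power z n"
  by (simp add: word_power_def replicate_add)

text \<open>The last of the \<open>k\<close> copies of \<open>z\<close> is itself a suffix of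
  \<open>w\<close>, so bounding the quantifier loses nothing. This needs at least one copy, hence
  \<open>k > 0\<close>.\<close>

lemma ends_with_power_iff:
  assumes "k > 0"
  shows "ends_with_power k w \<longleftrightarrow> (\<exists>z. z \<noteq> [] \<and> suffix (word_power z k) w)"
proof -
  have "suffix z w" if "suffix (word_power z k) w" for z
  proof -
    have "word_power z k = word_power z (k - 1) @ z"
      using assms word_power_add[of z "k - 1" 1] by simp
    with that show ?thesis
      by (metis suffixI suffix_order.trans)
  qed
  then show ?thesis
    unfolding ends_with_power_def by auto
qed

lemma cubefree_butlast: "cubefree (x @ [a]) \<Longrightarrow> cubefree x"
  unfolding cubefree_def by (metis append_assoc sublist_def)

lemma cubefree_not_ends_with_cube: "cubefree x \<Longrightarrow> \<not> ends_with_power 3 x"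
  by (auto simp: cubefree_def ends_with_power_iff)

text \<open>A final power with exponent above 2 would end in a cube, which leaves only the exponents
  1 and 2; exponent 1 is always attained, by \<open>z = u\<close>.\<close>

lemma curling_number_cubefree:
  assumes "cubefree u" "u \<noteq> []"
  shows "curling_number u = (if ends_with_power 2 u then 2 else 1)"
proof -
  let ?K = "{k. k \<ge> 1 \<and> (\<exists>y z. z \<noteq> [] \<and> u = y @ word_power z k)}"
  have le2: "k \<le> 2" if "k \<in> ?K" for k
  proof (rule ccontr)
    assume "\<not> k \<le> 2"
    from that obtain y z where z: "z \<noteq> []" "u = y @ word_power z k" by auto
    have "word_power z k = word_power z (k - 3) @ word_power z 3"
      using \<open>\<not> k \<le> 2\<close> word_power_add[of z "k - 3" 3] by simp
    then have "ends_with_power 3 u"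
      using z by (auto simp: ends_with_power_iff suffix_def)
    with assms(1) show False
      by (simp add: cubefree_not_ends_with_cube)
  qed
  have one: "1 \<in> ?K"
    using assms(2) by auto
  have two: "2 \<in> ?K \<longleftrightarrow> ends_with_power 2 u"
    by (auto simp: ends_with_power_iff suffix_def)
  have "?K = (if ends_with_power 2 u then {1, 2} else {1})"
  proof (rule set_eqI)
    fix k :: nat
    consider "k = 0" | "k = 1" | "k = 2" | "k > 2" by linarith
    then show "k \<in> ?K \<longleftrightarrow> k \<in> (if ends_with_power 2 u then {1, 2} else {1})"
    proof cases
      case 4
      with le2[of k] show ?thesis by auto
    qed (use one two in auto)
  qed
  then show ?thesis
    by (simp add: curling_number_def)
qed

lemma curling_transform_snoc:
  "curling_transform (x @ [a]) = curling_transform x @ [curling_number (x @ [a])]"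
  by (simp add: curling_transform_def)

text \<open>Each word travels with its transform, which grows by one letter per step. Testing for
  cubes at the end suffices, since a cube ending earlier was rejected at a shorter prefix.\<close>

fun extensions :: "nat list \<times> nat list \<Rightarrow> (nat list \<times> nat list) list" where
  "extensions (w, c) =
     filter (\<lambda>(w', c'). \<not> ends_with_power 3 w' \<and> \<not> ends_with_power 3 c')
       (map (\<lambda>a. (w @ [a], c @ [if ends_with_power 2 (w @ [a]) then 2 else 1])) [0, 1])"

fun candidates :: "nat \<Rightarrow> (nat list \<times> nat list) list" where
  "candidates 0 = [([], [])]"
| "candidates (Suc n) = concat (map extensions (candidates n))"

text \<open>Removing the last letter of \<open>x\<close> also removes the last letter of its
  transform, so both stay cubefree and induction from the right applies. Only this inclusion is
  needed to rule words out.\<close>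

lemma candidates_complete:
  assumes "set x \<subseteq> {0, 1}" "cubefree x" "cubefree (curling_transform x)"
  shows "(x, curling_transform x) \<in> set (candidates (length x))"
  using assms
proof (induction x rule: rev_induct)
  case Nil
  then show ?case by (simp add: curling_transform_def)
next
  case (snoc a x)
  let ?c = "curling_transform x"
  have a: "a \<in> {0, 1}"
    using snoc.prems(1) by simp
  have c: "curling_transform (x @ [a]) = ?c @ [if ends_with_power 2 (x @ [a]) then 2 else 1]"
    using curling_number_cubefree[OF snoc.prems(2)] by (simp add: curling_transform_snoc)
  have "(x, ?c) \<in> set (candidates (length x))"
    using snoc.IH snoc.prems cubefree_butlast[of x a] cubefree_butlast[of ?c]
    by (simp add: curling_transform_snoc)
  moreover have "(x @ [a], curling_transform (x @ [a])) \<in> set (extensions (x, ?c))"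
    using a cubefree_not_ends_with_cube[OF snoc.prems(2)]
      cubefree_not_ends_with_cube[OF snoc.prems(3)]
    by (auto simp: c)
  ultimately show ?case
    \<comment> \<open>Keeping \<open>extensions\<close> folded lets the two memberships above match
      the unfolded \<open>candidates\<close> directly.\<close>
    by (auto simp del: extensions.simps)
qed

text \<open>The exhaustive search itself, carried out by rewriting with the code equations.\<close>

lemma candidates_18: "candidates 18 = []"
  by code_simp

text \<open>Every level is built from the one before, so an empty level leaves all later ones
  empty.\<close>

lemma candidates_empty: "18 \<le> n \<Longrightarrow> candidates n = []"
  by (induction n rule: dec_induct) (simp_all add: candidates_18)

theorem theorem2:
  shows "\<not> (\<exists>x :: nat list. set x \<subseteq> {0, 1} \<and> length x > 17 \<and>
           cubefree x \<and> cubefree (curling_transform x))"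
proof
  assume "\<exists>x :: nat list. set x \<subseteq> {0, 1} \<and> length x > 17 \<and>
           cubefree x \<and> cubefree (curling_transform x)"
  then obtain x :: "nat list" where "set x \<subseteq> {0, 1}" "length x > 17"
    "cubefree x" "cubefree (curling_transform x)" by blast
  with candidates_complete[of x] candidates_empty[of "length x"] show False
    by simp
qed

end
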